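(* Let $r\geq 2$. If $G$ is a co-chordal graph (i.e. its complement graph is chordal), then $\Sigma_r(G)$ is vertex decomposable.
   Context: $\Sigma_r(G)$ is the simplicial complex generated by the sets $V(G)\setminus W$ over all $r$-subsets $W\subseteq V(G)$ with $G[W]$ connected (void complex if none). A graph is chordal if it has no induced cycle of length $\ge 4$. Vertex decomposable: the complex is a simplex, the empty complex $\{\emptyset\}$, the void complex, or has a vertex $x$ with $\mathrm{lk}(x)$ and $\mathrm{del}(x)$ vertex decomposable and every facet of $\mathrm{del}(x)$ a facet of the complex. *)

theory Defs
  imports "Graph_Theory.Graph_Theory"
begin

text \<open>
  Finite simple graphs are the loop-free symmetric digraphs of \<^locale>\<open>pair_graph\<close>: the edge
  \<open>{u, v}\<close> is represented by the two arcs \<open>(u, v)\<close> and \<open>(v, u)\<close>.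
\<close>

definition graph_complement :: "'a pair_pre_digraph \<Rightarrow> 'a pair_pre_digraph" where
  "graph_complement G = \<lparr> pverts = pverts G,
     parcs = {(u, v). u \<in> pverts G \<and> v \<in> pverts G \<and> u \<noteq> v \<and> (u, v) \<notin> parcs G} \<rparr>"

lemma pair_graph_graph_complement:
  assumes "pair_graph G"
  shows "pair_graph (graph_complement G)"
proof -
  interpret pair_graph G by (fact assms)
  have finV: "finite (pverts (graph_complement G))"
    by (simp add: graph_complement_def)
  have finA: "finite (parcs (graph_complement G))"
    by (rule finite_subset[of _ "pverts G \<times> pverts G"]) (auto simp: graph_complement_def)
  have arcs_sym: "(v, u) \<in> parcs G" if "(u, v) \<in> parcs G" for u v
    using graph_symmetric[of u v] that by simp
  have "symmetric (with_proj (graph_complement G))"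
    unfolding symmetric_def with_proj_simps
    by (rule symI) (auto simp: graph_complement_def dest: arcs_sym)
  with finV finA show ?thesis
    by unfold_locales (simp_all add: graph_complement_def split: prod.splits)
qed

text \<open>
  The list \<open>vs\<close> enumerates, in cyclic order, a vertex set on which \<open>G\<close> induces a cycle of length
  \<open>length vs\<close>.  (Lists of length less than 3 are not cycles and are excluded explicitly.)
\<close>
definition induced_cycle :: "'a pair_pre_digraph \<Rightarrow> 'a list \<Rightarrow> bool" where
  "induced_cycle G vs \<longleftrightarrow>
     length vs \<ge> 3 \<and> distinct vs \<and> set vs \<subseteq> pverts G \<and>
     (\<forall>i < length vs. \<forall>j < length vs.
        (vs ! i, vs ! j) \<in> parcs G \<longleftrightarrow>
          j = Suc i mod length vs \<or> i = Suc j mod length vs)"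

definition chordal :: "'a pair_pre_digraph \<Rightarrow> bool" where
  "chordal G \<longleftrightarrow> \<not> (\<exists>vs. induced_cycle G vs \<and> length vs \<ge> 4)"

definition co_chordal :: "'a pair_pre_digraph \<Rightarrow> bool" where
  "co_chordal G \<longleftrightarrow> chordal (graph_complement G)"

text \<open>
  A complex is its set of faces.  The void complex \<open>{}\<close> and the empty complex \<open>{{}}\<close> are
  both allowed and are different; not every element of a surrounding ground set need be a vertex.
\<close>
definition simplicial_complex :: "'a set set \<Rightarrow> bool" where
  "simplicial_complex \<Delta> \<longleftrightarrow> finite (\<Union>\<Delta>) \<and> (\<forall>F\<in>\<Delta>. \<forall>F'. F' \<subseteq> F \<longrightarrow> F' \<in> \<Delta>)"

definition generated_complex :: "'a set set \<Rightarrow> 'a set set" where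
  "generated_complex \<S> = {F. \<exists>A\<in>\<S>. F \<subseteq> A}"

definition facets :: "'a set set \<Rightarrow> 'a set set" where
  "facets \<Delta> = {F \<in> \<Delta>. \<forall>F'\<in>\<Delta>. F \<subseteq> F' \<longrightarrow> F' = F}"

definition complex_link :: "'a set set \<Rightarrow> 'a \<Rightarrow> 'a set set" where
  "complex_link \<Delta> x = {F. x \<notin> F \<and> insert x F \<in> \<Delta>}"

definition complex_del :: "'a set set \<Rightarrow> 'a \<Rightarrow> 'a set set" where
  "complex_del \<Delta> x = {F \<in> \<Delta>. x \<notin> F}"

inductive vertex_decomposable :: "'a set set \<Rightarrow> bool" where
  simplex: "finite F \<Longrightarrow> vertex_decomposable (Pow F)"
| empty: "vertex_decomposable {{}}"
| void: "vertex_decomposable {}"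
| shed: "\<lbrakk> simplicial_complex \<Delta>; x \<in> \<Union>\<Delta>;
           vertex_decomposable (complex_link \<Delta> x);
           vertex_decomposable (complex_del \<Delta> x);
           facets (complex_del \<Delta> x) \<subseteq> facets \<Delta> \<rbrakk>
         \<Longrightarrow> vertex_decomposable \<Delta>"

definition sigma_complex :: "nat \<Rightarrow> 'a pair_pre_digraph \<Rightarrow> 'a set set" where
  "sigma_complex r G = generated_complex
     {pverts G - W | W. W \<subseteq> pverts G \<and> card W = r \<and> connected (with_proj G \<restriction> W)}"

lemma simplicial_complex_sigma_complex:
  assumes "pair_graph G"
  shows "simplicial_complex (sigma_complex r G)"
proof -
  interpret pair_graph G by (fact assms)
  have "\<Union>(sigma_complex r G) \<subseteq> pverts G"
    unfolding sigma_complex_def generated_complex_def by blast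
  then have "finite (\<Union>(sigma_complex r G))"
    by (rule finite_subset) (rule pair_finite_verts)
  moreover have "F' \<in> sigma_complex r G" if "F \<in> sigma_complex r G" "F' \<subseteq> F" for F F'
    using that unfolding sigma_complex_def generated_complex_def by (blast intro: subset_trans)
  ultimately show ?thesis
    unfolding simplicial_complex_def by blast
qed

end

theory Submission
  imports Defs
begin

text \<open>
  A vertex \<open>x\<close> that is simplicial in the complement of \<open>G\<close> (one exists by Dirac's theorem) is a
  shedding vertex: its non-neighbours in \<open>G\<close> are independent, so every connected set \<open>W\<close> with at
  least two vertices has a neighbour of \<open>x\<close>, and some vertex of \<open>W\<close> can be exchanged for \<open>x\<close>
  because a connected graph has a non-cut vertex other than \<open>x\<close>.  The link of \<open>x\<close> is the same
  complex for \<open>G - x\<close>.  The deletion comes from the sets \<open>U\<close> with \<open>r - 1\<close> elements for which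
  \<open>U \<union> {x}\<close> is connected; there one continues by shedding neighbours of the connected root set
  built so far.
\<close>

section \<open>Connected vertex sets\<close>

text \<open>Connectivity in terms of cuts, which makes adding a neighbour immediate.\<close>

definition linked :: "'a rel \<Rightarrow> 'a set \<Rightarrow> bool" where
  "linked E W \<longleftrightarrow> W \<noteq> {} \<and>
     (\<forall>S. S \<noteq> {} \<longrightarrow> S \<subset> W \<longrightarrow> (\<exists>a\<in>S. \<exists>b\<in>W - S. (a, b) \<in> E))"

lemma linked_cutE:
  assumes "linked E W" "S \<noteq> {}" "S \<subset> W"
  obtains a b where "a \<in> S" "b \<in> W - S" "(a, b) \<in> E"
  using assms unfolding linked_def by blast

lemma linked_nonempty: "linked E W \<Longrightarrow> W \<noteq> {}"
  by (simp add: linked_def)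

lemma linked_singleton: "linked E {x}"
  unfolding linked_def by auto

lemma linked_insert:
  assumes "sym E" "linked E S" "a \<in> S" "(a, y) \<in> E"
  shows "linked E (insert y S)"
  unfolding linked_def
proof (intro conjI allI impI)
  fix A assume A: "A \<noteq> {}" "A \<subset> insert y S"
  \<comment> \<open>A cut of \<open>insert y S\<close> is \<open>{y}\<close>, or contains all of
    \<open>S\<close> and hence equals it, or cuts \<open>S\<close> properly; the edge between
    \<open>a\<close> and \<open>y\<close> serves the first two cases.\<close>
  consider "A \<inter> S = {}" | "S \<subseteq> A" | "A \<inter> S \<noteq> {}" "A \<inter> S \<subset> S" by blast
  then show "\<exists>p\<in>A. \<exists>q\<in>insert y S - A. (p, q) \<in> E"
  proof cases
    case 1
    then have "A = {y}" using A by blast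
    moreover have "(y, a) \<in> E" using assms by (auto dest: symD)
    ultimately show ?thesis using 1 assms(3) by auto
  next
    case 2
    then show ?thesis using A assms(3,4) by auto
  next
    case 3
    then show ?thesis using linked_cutE[OF assms(2) 3] by blast
  qed
qed simp

text \<open>A maximal linked proper subset \<open>M\<close> of \<open>T\<close> containing
  \<open>S\<close> has a neighbour \<open>w\<close> in \<open>T\<close>. Adding \<open>w\<close>
  keeps it linked, so by maximality this already gives all of \<open>T\<close>, and \<open>w\<close>
  is a non-cut vertex. Keeping \<open>S\<close> intact is what the later exchange arguments
  need.\<close>

lemma linked_noncut_vertex:
  assumes "sym E" "finite T" "linked E T" "linked E S" "S \<subset> T"
  obtains u where "u \<in> T - S" "linked E (T - {u})"
proof -
  define P where "P = {M. linked E M \<and> S \<subseteq> M \<and> M \<subset> T}"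
  have "finite P" unfolding P_def by (rule finite_subset[of _ "Pow T"]) (use assms in auto)
  moreover have "S \<in> P" using assms by (simp add: P_def)
  ultimately obtain M where "M \<in> P" and max: "\<forall>N\<in>P. M \<subseteq> N \<longrightarrow> M = N"
    by (meson finite_has_maximal2)
  then have M: "linked E M" "S \<subseteq> M" "M \<subset> T" by (simp_all add: P_def)
  obtain a w where w: "a \<in> M" "w \<in> T - M" "(a, w) \<in> E"
    using linked_cutE[OF assms(3) linked_nonempty[OF M(1)] M(3)] .
  have "insert w M \<notin> P" using max w(2) by blast
  moreover have "linked E (insert w M)" using linked_insert[OF assms(1) M(1) w(1,3)] .
  ultimately have "insert w M = T" using M(2,3) w(2) by (auto simp: P_def)
  then have "T - {w} = M" using w(2) by blast
  then show thesis using that[of w] w(2) M by blast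
qed

lemma connected_induce_iff_linked:
  assumes "pair_graph G"
  shows "connected (with_proj G \<restriction> W) \<longleftrightarrow> linked (parcs G) W"
proof -
  interpret pair_graph G by (fact assms)
  interpret S: wf_digraph "with_proj G \<restriction> W"
    by (rule wellformed_induce_subgraph)
  let ?E = "parcs G \<inter> W \<times> W"
  have ends: "arcs_ends (with_proj G \<restriction> W) = ?E"
    by (auto simp: arcs_ends_conv induce_subgraph_def)
  have "sym (parcs G)"
    using pair_sym_arcs by (simp add: symmetric_def)
  \<comment> \<open>\<open>connected\<close> refers to the symmetric closure of the arcs, which
    changes nothing for a symmetric graph.\<close>
  then have E: "symcl ?E = ?E"
    by (auto simp: symcl_def dest: symD)
  have conn: "connected (with_proj G \<restriction> W) \<longleftrightarrow>
      W \<noteq> {} \<and> (\<forall>u\<in>W. \<forall>v\<in>W. (u, v) \<in> rtrancl_on W ?E)"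
    unfolding connected_conv ends E by simp
  show ?thesis
  proof
    assume c: "connected (with_proj G \<restriction> W)"
    show "linked (parcs G) W"
      unfolding linked_def
    proof (intro conjI allI impI)
      fix S assume S: "S \<noteq> {}" "S \<subset> W"
      then obtain u v where uv: "u \<in> S" "v \<in> W - S" by blast
      with S c conn have "(u, v) \<in> rtrancl_on W ?E" by blast
      \<comment> \<open>A walk starting in \<open>S\<close> stays in \<open>S\<close> until it uses
        an arc leaving \<open>S\<close>.\<close>
      moreover have "w \<in> S \<or> (\<exists>a\<in>S. \<exists>b\<in>W - S. (a, b) \<in> parcs G)"
        if "(u, w) \<in> rtrancl_on W ?E" for w
        using that by (induction rule: rtrancl_on_induct) (use uv(1) in auto)
      ultimately show "\<exists>a\<in>S. \<exists>b\<in>W - S. (a, b) \<in> parcs G" using uv(2) by blast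
    qed (use c conn in blast)
  next
    assume l: "linked (parcs G) W"
    have "(u, v) \<in> rtrancl_on W ?E" if "u \<in> W" "v \<in> W" for u v
    proof (rule ccontr)
      \<comment> \<open>The vertices reachable from \<open>u\<close> would form a cut that no arc
        leaves.\<close>
      let ?S = "{w \<in> W. (u, w) \<in> rtrancl_on W ?E}"
      assume "(u, v) \<notin> rtrancl_on W ?E"
      then have "u \<in> ?S" "?S \<subset> W" using that by auto
      from \<open>u \<in> ?S\<close> have "?S \<noteq> {}" by force
      from linked_cutE[OF l this \<open>?S \<subset> W\<close>]
      obtain a b where ab: "a \<in> ?S" "b \<in> W - ?S" "(a, b) \<in> parcs G" .
      then have "(u, a) \<in> rtrancl_on W ?E" "(a, b) \<in> ?E" "b \<in> W" by auto
      then have "(u, b) \<in> rtrancl_on W ?E" by (rule rtrancl_on_into_rtrancl_on)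
      then show False using ab(2) by blast
    qed
    then show "connected (with_proj G \<restriction> W)"
      using conn linked_nonempty[OF l] by blast
  qed
qed

section \<open>Simplicial vertices of chordal graphs\<close>

lemma linked_walk:
  assumes "linked E X" "s \<in> X" "t \<in> X"
  obtains p where "p \<noteq> []" "hd p = s" "last p = t" "set p \<subseteq> X"
    "successively (\<lambda>x y. (x, y) \<in> E) p"
proof -
  let ?walk = "\<lambda>w p. p \<noteq> [] \<and> hd p = s \<and> last p = w \<and> set p \<subseteq> X \<and>
    successively (\<lambda>x y. (x, y) \<in> E) p"
  let ?R = "{w \<in> X. \<exists>p. ?walk w p}"
  have "?walk s [s]" using assms by simp
  then have "s \<in> ?R" using assms by blast
  have "?R = X"
  proof (rule ccontr)
    assume "?R \<noteq> X"
    then have "?R \<subset> X" by blast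
    with \<open>s \<in> ?R\<close> assms(1) obtain a b where ab: "a \<in> ?R" "b \<in> X - ?R" "(a, b) \<in> E"
      by (metis (no_types, lifting) empty_iff linked_cutE)
    then obtain p where "?walk a p" by blast
    then have "?walk b (p @ [b])" using ab by (auto simp: successively_append_iff)
    then show False using ab by blast
  qed
  then show thesis using assms(3) that by blast
qed

text \<open>A walk of minimal length works: a repeated vertex or a forward chord would give a
  shortcut. Only \<open>i < j\<close> is treated because \<open>E\<close> need not be
  symmetric.\<close>

lemma linked_induced_path:
  assumes "linked E X" "s \<in> X" "t \<in> X"
  obtains p where "p \<noteq> []" "hd p = s" "last p = t" "set p \<subseteq> X" "distinct p"
    "\<And>i j. i < j \<Longrightarrow> j < length p \<Longrightarrow> (p ! i, p ! j) \<in> E \<longleftrightarrow> j = Suc i"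
proof -
  let ?walk = "\<lambda>p. p \<noteq> [] \<and> hd p = s \<and> last p = t \<and> set p \<subseteq> X \<and>
    successively (\<lambda>x y. (x, y) \<in> E) p"
  obtain p0 where "?walk p0" using linked_walk[OF assms] by blast
  then obtain p where p: "?walk p" and min: "\<And>q. ?walk q \<Longrightarrow> length p \<le> length q"
    using ex_has_least_nat[of ?walk p0 length] by blast
  have "distinct p"
  proof (rule ccontr)
    assume "\<not> distinct p"
    then obtain xs ys zs y where "p = xs @ [y] @ ys @ [y] @ zs"
      using not_distinct_decomp by blast
    with p have "?walk (xs @ [y] @ zs)"
      by (auto simp: successively_append_iff successively_Cons hd_append split: if_splits)
    from min[OF this] show False using \<open>p = _\<close> by simp
  qed
  moreover have "(p ! i, p ! j) \<in> E \<longleftrightarrow> j = Suc i" if ij: "i < j" "j < length p" for i j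
  proof
    assume e: "(p ! i, p ! j) \<in> E"
    \<comment> \<open>The chord bypasses the entries strictly between \<open>i\<close> and
      \<open>j\<close>; minimality then leaves no such entries.\<close>
    let ?q = "take (Suc i) p @ drop j p"
    have "last (take (Suc i) p) = p ! i"
      using ij by (simp add: take_Suc_conv_app_nth)
    moreover have "hd (drop j p) = p ! j" using ij by (simp add: hd_drop_conv_nth)
    moreover have "successively (\<lambda>x y. (x, y) \<in> E) (take (Suc i) p)"
      "successively (\<lambda>x y. (x, y) \<in> E) (drop j p)"
      using p by (metis append_take_drop_id successively_append_iff)+
    ultimately have "?walk ?q"
      using p ij e
      by (auto simp: successively_append_iff dest: in_set_takeD in_set_dropD)
    from min[OF this] show "j = Suc i" using ij by simp
  next
    assume "j = Suc i"
    then show "(p ! i, p ! j) \<in> E"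
      using p ij by (auto simp: successively_conv_nth)
  qed
  ultimately show thesis using that[of p] p by blast
qed

text \<open>Placing \<open>v\<close> at index 0 shifts the path by one, so the cyclic successor
  wraps around only at the last path vertex, the second neighbour of \<open>v\<close>. Symmetry
  reduces the check to \<open>i < j\<close>.\<close>

lemma induced_cycle_Cons:
  assumes H: "pair_graph H" and "v \<in> pverts H" and "set p \<subseteq> pverts H" and "v \<notin> set p"
    and p: "distinct p" "length p \<ge> 2"
    and path: "\<And>i j. i < j \<Longrightarrow> j < length p \<Longrightarrow> (p ! i, p ! j) \<in> parcs H \<longleftrightarrow> j = Suc i"
    and ends: "\<And>i. i < length p \<Longrightarrow>
      (v, p ! i) \<in> parcs H \<longleftrightarrow> i = 0 \<or> Suc i = length p"
  shows "induced_cycle H (v # p)"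
proof -
  interpret pair_graph H by (fact H)
  have sym: "(x, y) \<in> parcs H \<longleftrightarrow> (y, x) \<in> parcs H" for x y
    using pair_sym_arcs by (auto simp: symmetric_def dest: symD)
  have irr: "(x, x) \<notin> parcs H" for x
    using pair_no_loops[of "(x, x)"] by auto
  let ?n = "length (v # p)"
  have adj: "((v # p) ! i, (v # p) ! j) \<in> parcs H \<longleftrightarrow>
      j = Suc i mod ?n \<or> i = Suc j mod ?n" if ij: "i < j" "j < ?n" for i j
  proof -
    obtain j' where j': "j = Suc j'" "j' < length p" using ij by (cases j) auto
    have i: "Suc i mod ?n = Suc i" using ij by simp
    have j: "Suc j mod ?n = (if Suc j = ?n then 0 else Suc j)" using ij by auto
    show ?thesis
    proof (cases i)
      case 0
      then show ?thesis using ends[OF j'(2)] j' i j by auto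
    next
      case (Suc i')
      then show ?thesis using path[of i' j'] ij j' i j by auto
    qed
  qed
  have diag: "i \<noteq> Suc i mod ?n" if "i < ?n" for i
    using that p by (cases "Suc i = ?n") auto
  have "((v # p) ! i, (v # p) ! j) \<in> parcs H \<longleftrightarrow>
      j = Suc i mod ?n \<or> i = Suc j mod ?n" if "i < ?n" "j < ?n" for i j
  proof (cases i j rule: linorder_cases)
    case less
    then show ?thesis using adj that by blast
  next
    case equal
    then show ?thesis using irr diag that by metis
  next
    case greater
    then show ?thesis using adj[of j i] that sym by blast
  qed
  then show ?thesis
    unfolding induced_cycle_def using assms by auto
qed

text \<open>If \<open>s\<close> and \<open>t\<close> were not adjacent, a shortest path between them through \<open>C\<close> would close up
  at \<open>v\<close> to an induced cycle of length at least four.\<close>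

lemma chordal_attachments_adjacent:
  assumes H: "pair_graph H" "chordal H" and V: "C \<subseteq> pverts H" "v \<notin> C"
    and C: "linked (parcs H) C" "\<And>c. c \<in> C \<Longrightarrow> (v, c) \<notin> parcs H"
    and s: "(v, s) \<in> parcs H" "a \<in> C" "(a, s) \<in> parcs H"
    and t: "(v, t) \<in> parcs H" "b \<in> C" "(b, t) \<in> parcs H"
    and "s \<noteq> t"
  shows "(s, t) \<in> parcs H"
proof (rule ccontr)
  interpret pair_graph H by (fact H)
  assume st: "(s, t) \<notin> parcs H"
  have sym: "sym (parcs H)"
    using pair_sym_arcs by (simp add: symmetric_def)
  have "linked (parcs H) (insert s (insert t C))"
    using linked_insert[OF sym linked_insert[OF sym C(1) t(2,3)], of a s] s by blast
  then obtain p where p: "p \<noteq> []" "hd p = s" "last p = t" "set p \<subseteq> insert s (insert t C)"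
    "distinct p"
    and path: "\<And>i j. i < j \<Longrightarrow> j < length p \<Longrightarrow> (p ! i, p ! j) \<in> parcs H \<longleftrightarrow> j = Suc i"
    by (rule linked_induced_path[of _ _ s t]) auto
  have ends: "p ! 0 = s" "p ! (length p - 1) = t"
    using p by (auto simp: hd_conv_nth last_conv_nth)
  have "length p \<noteq> 1" using ends \<open>s \<noteq> t\<close> by auto
  moreover have "length p \<noteq> 2" using path[of 0 1] ends st by auto
  moreover have "length p \<noteq> 0" using p by simp
  ultimately have len: "length p \<ge> 3" by linarith
  \<comment> \<open>No vertex of \<open>C\<close> is adjacent to \<open>v\<close>, so only
    \<open>s\<close> and \<open>t\<close> are, and by distinctness they occur only at the two
    ends.\<close>
  have adj: "(v, p ! i) \<in> parcs H \<longleftrightarrow> i = 0 \<or> Suc i = length p" if i: "i < length p" for i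
  proof -
    have pos: "0 < length p" "length p - 1 < length p" using len by linarith+
    have "p ! i = s \<longleftrightarrow> i = 0"
      using nth_eq_iff_index_eq[OF p(5) i pos(1)] ends by simp
    moreover have "p ! i = t \<longleftrightarrow> Suc i = length p"
      using nth_eq_iff_index_eq[OF p(5) i pos(2)] ends pos by auto
    moreover have "p ! i \<in> insert s (insert t C)" using p(4) i nth_mem by blast
    ultimately show ?thesis using C(2) s(1) t(1) by blast
  qed
  have "v \<noteq> s" "v \<noteq> t" using s(1) t(1) pair_no_loops[of "(v, v)"] by auto
  then have "v \<notin> set p" using p(4) V by blast
  moreover have "v \<in> pverts H" "set p \<subseteq> pverts H"
    using s(1) t(1) p(4) V in_arcsD1 in_arcsD2 by blast+
  ultimately have "induced_cycle H (v # p)"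
    using induced_cycle_Cons[OF H(1) _ _ _ p(5) _ path adj] len by simp
  then show False using H(2) len unfolding chordal_def by fastforce
qed

text \<open>Dirac's theorem in the form suited to induction: the simplicial vertex can be chosen at
  distance at least two from any given vertex that is not adjacent to all others.\<close>

lemma chordal_simplicial_nonneighbour:
  assumes "pair_graph H" "chordal H" "X \<subseteq> pverts H"
    and "v \<in> X" "u \<in> X" "u \<noteq> v" "(v, u) \<notin> parcs H"
  shows "\<exists>z\<in>X. z \<noteq> v \<and> (v, z) \<notin> parcs H \<and>
    (\<forall>a\<in>X. \<forall>b\<in>X. (z, a) \<in> parcs H \<longrightarrow> (z, b) \<in> parcs H \<longrightarrow> a \<noteq> b \<longrightarrow> (a, b) \<in> parcs H)"
  using assms(3-)
proof (induction "card X" arbitrary: X u v rule: less_induct)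
  case less
  interpret pair_graph H by (fact assms)
  let ?E = "parcs H"
  have sym: "sym ?E"
    using pair_sym_arcs by (simp add: symmetric_def)
  have irr: "(x, x) \<notin> ?E" for x
    using pair_no_loops[of "(x, x)"] by auto
  have finX: "finite X" using less.prems(1) pair_finite_verts by (rule finite_subset)
  define Y where "Y = {y \<in> X. y \<noteq> v \<and> (v, y) \<notin> ?E}"
  let ?P = "{M. linked ?E M \<and> M \<subseteq> Y}"
  have "finite ?P" by (rule finite_subset[of _ "Pow X"]) (use finX in \<open>auto simp: Y_def\<close>)
  moreover have "{u} \<in> ?P" using less.prems by (simp add: Y_def linked_singleton)
  \<comment> \<open>\<open>C\<close> is a connected component of the subgraph induced on
    \<open>Y\<close>, the non-neighbours of \<open>v\<close> in \<open>X\<close>.\<close>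
  ultimately obtain C where C: "linked ?E C" "C \<subseteq> Y"
    and max: "\<And>N. linked ?E N \<Longrightarrow> N \<subseteq> Y \<Longrightarrow> C \<subseteq> N \<Longrightarrow> N = C"
    using finite_has_maximal2[of ?P] by (metis (no_types, lifting) mem_Collect_eq)
  \<comment> \<open>The boundary of \<open>C\<close> in \<open>X\<close>. A boundary vertex not
    adjacent to \<open>v\<close> would enlarge \<open>C\<close>, so \<open>S\<close> consists of
    neighbours of \<open>v\<close>, and chordality makes it a clique.\<close>
  define S where "S = {s \<in> X - C. \<exists>c\<in>C. (c, s) \<in> ?E}"
  have vS: "(v, s) \<in> ?E" if "s \<in> S" for s
  proof (rule ccontr)
    assume n: "(v, s) \<notin> ?E"
    from that obtain c where c: "c \<in> C" "(c, s) \<in> ?E" by (auto simp: S_def)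
    have "s \<noteq> v" using c C(2) sym by (auto simp: Y_def dest: symD)
    then have "insert s C \<subseteq> Y" using n that C(2) by (auto simp: Y_def S_def)
    then have "insert s C = C" using max linked_insert[OF sym C(1) c] by blast
    then show False using that by (auto simp: S_def)
  qed
  have clique: "(s, t) \<in> ?E" if "s \<in> S" "t \<in> S" "s \<noteq> t" for s t
  proof -
    from that obtain a b where "a \<in> C" "(a, s) \<in> ?E" "b \<in> C" "(b, t) \<in> ?E"
      by (auto simp: S_def)
    then show ?thesis
      using chordal_attachments_adjacent[OF assms(1,2) _ _ C(1) _ vS[OF that(1)] _ _ vS[OF that(2)]]
        C(2) less.prems(1) that(3) by (auto simp: Y_def)
  qed
  \<comment> \<open>This set misses \<open>v\<close>, so induction applies. It contains all
    neighbours in \<open>X\<close> of vertices of \<open>C\<close>, so a vertex of \<open>C\<close>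
    that is simplicial here is simplicial in \<open>X\<close>.\<close>
  let ?X = "C \<union> S"
  have sub: "?X \<subseteq> X" using C(2) by (auto simp: Y_def S_def)
  have "v \<notin> ?X" using C(2) vS irr by (auto simp: Y_def)
  with sub less.prems(2) finX have small: "card ?X < card X"
    by (metis psubsetI psubset_card_mono)
  have nbr: "a \<in> ?X" if "z \<in> C" "a \<in> X" "(z, a) \<in> ?E" for z a
    using that by (auto simp: S_def)
  have "\<exists>z\<in>C. \<forall>a\<in>?X. \<forall>b\<in>?X. (z, a) \<in> ?E \<longrightarrow> (z, b) \<in> ?E \<longrightarrow> a \<noteq> b \<longrightarrow> (a, b) \<in> ?E"
  proof (cases "\<exists>x\<in>?X. \<exists>y\<in>?X. x \<noteq> y \<and> (x, y) \<notin> ?E")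
    case False
    then show ?thesis using linked_nonempty[OF C(1)] by blast
  next
    case True
    \<comment> \<open>The new base vertex \<open>x\<close> is chosen adjacent to all other vertices
      of \<open>S\<close>; the simplicial non-neighbour found by induction then lies in
      \<open>C\<close>. If some vertex of \<open>S\<close> misses another vertex of
      \<open>?X\<close>, it serves because \<open>S\<close> is a clique; otherwise every vertex of
      \<open>?X\<close> sees the rest of \<open>S\<close>.\<close>
    obtain x y where xy: "x \<in> ?X" "y \<in> ?X" "y \<noteq> x" "(x, y) \<notin> ?E"
      and xS: "\<And>s. s \<in> S \<Longrightarrow> s = x \<or> (x, s) \<in> ?E"
    proof (cases "\<exists>x\<in>S. \<exists>y\<in>?X. x \<noteq> y \<and> (x, y) \<notin> ?E")
      case True
      then obtain x y where "x \<in> S" "y \<in> ?X" "x \<noteq> y" "(x, y) \<notin> ?E" by blast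
      then show thesis using that[of x y] clique by blast
    next
      case False
      with True obtain x y where "x \<in> ?X" "y \<in> ?X" "x \<noteq> y" "(x, y) \<notin> ?E" by blast
      then show thesis using that[of x y] False sym by (metis UnCI symD)
    qed
    have "?X \<subseteq> pverts H" using sub less.prems(1) by blast
    from less.hyps[OF small this xy] xS show ?thesis by blast
  qed
  then obtain z where z: "z \<in> C"
    "\<forall>a\<in>?X. \<forall>b\<in>?X. (z, a) \<in> ?E \<longrightarrow> (z, b) \<in> ?E \<longrightarrow> a \<noteq> b \<longrightarrow> (a, b) \<in> ?E" by blast
  show ?case
  proof (intro bexI[of _ z] conjI)
    show "z \<in> X" "z \<noteq> v" "(v, z) \<notin> ?E" using z(1) C(2) by (auto simp: Y_def)
    show "\<forall>a\<in>X. \<forall>b\<in>X. (z, a) \<in> ?E \<longrightarrow> (z, b) \<in> ?E \<longrightarrow> a \<noteq> b \<longrightarrow> (a, b) \<in> ?E"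
      using z nbr by blast
  qed
qed

lemma chordal_simplicial_vertex:
  assumes "pair_graph H" "chordal H" "X \<subseteq> pverts H" "X \<noteq> {}"
  obtains z where "z \<in> X"
    "\<And>a b. a \<in> X \<Longrightarrow> b \<in> X \<Longrightarrow> (z, a) \<in> parcs H \<Longrightarrow> (z, b) \<in> parcs H \<Longrightarrow> a \<noteq> b \<Longrightarrow>
      (a, b) \<in> parcs H"
proof (cases "\<exists>v\<in>X. \<exists>u\<in>X. u \<noteq> v \<and> (v, u) \<notin> parcs H")
  case True
  then obtain v u where "v \<in> X" "u \<in> X" "u \<noteq> v" "(v, u) \<notin> parcs H" by blast
  from chordal_simplicial_nonneighbour[OF assms(1-3) this] obtain z where "z \<in> X"
    "\<forall>a\<in>X. \<forall>b\<in>X. (z, a) \<in> parcs H \<longrightarrow> (z, b) \<in> parcs H \<longrightarrow> a \<noteq> b \<longrightarrow> (a, b) \<in> parcs H"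
    by blast
  then show ?thesis by (intro that[of z]) simp_all
next
  case False
  then have "(a, b) \<in> parcs H" if "a \<in> X" "b \<in> X" "a \<noteq> b" for a b
    using that by metis
  moreover obtain z where "z \<in> X" using assms(4) by blast
  ultimately show ?thesis by (intro that[of z])
qed

section \<open>Shedding vertices of complexes given by complements of facets\<close>

text \<open>Describing facets by their complements turns link and deletion into operations on the
  family \<open>\<W>\<close>. For an antichain of subsets of \<open>X\<close>, this is the Alexander
  dual of the complex on \<open>X\<close> with minimal nonfaces \<open>\<W>\<close>.\<close>

abbreviation cofacet_complex :: "'a set \<Rightarrow> 'a set set \<Rightarrow> 'a set set" where
  "cofacet_complex X \<W> \<equiv> generated_complex ((-) X ` \<W>)"

lemma generated_complex_singleton: "generated_complex {A} = Pow A"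
  by (auto simp: generated_complex_def)

lemma generated_complex_empty: "generated_complex {} = {}"
  by (auto simp: generated_complex_def)

text \<open>The exchange hypothesis is the shedding condition: a face avoiding \<open>x\<close>
  inside \<open>X - W\<close> also avoids \<open>insert x (W - {u})\<close>, so the deletion is
  generated by facets of the whole complex.\<close>

lemma vertex_decomposable_cofacet_complex:
  assumes X: "finite X" "x \<in> X"
    and \<W>: "\<And>W. W \<in> \<W> \<Longrightarrow> W \<subseteq> X \<and> card W = r"
    and exchange: "\<And>W. W \<in> \<W> \<Longrightarrow> x \<notin> W \<Longrightarrow> \<exists>u\<in>W. insert x (W - {u}) \<in> \<W>"
    and link: "vertex_decomposable (cofacet_complex (X - {x}) {W \<in> \<W>. x \<notin> W})"
    and del: "vertex_decomposable (cofacet_complex (X - {x}) {U. x \<notin> U \<and> insert x U \<in> \<W>})"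
  shows "vertex_decomposable (cofacet_complex X \<W>)"
proof -
  let ?D = "cofacet_complex X \<W>" and ?J = "{U. x \<notin> U \<and> insert x U \<in> \<W>}"
  have mem: "F \<in> cofacet_complex Y \<V> \<longleftrightarrow> (\<exists>W\<in>\<V>. F \<subseteq> Y - W)" for F :: "'a set" and Y \<V>
    by (auto simp: generated_complex_def)
  have del_eq: "complex_del ?D x = cofacet_complex (X - {x}) ?J"
  proof (intro set_eqI iffI)
    fix F assume "F \<in> complex_del ?D x"
    then obtain W where W: "W \<in> \<W>" "F \<subseteq> X - W" "x \<notin> F"
      by (auto simp: complex_del_def mem)
    show "F \<in> cofacet_complex (X - {x}) ?J"
    proof (cases "x \<in> W")
      case True
      then have "W - {x} \<in> ?J" using W by (simp add: insert_absorb)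
      moreover have "F \<subseteq> X - {x} - (W - {x})" using W by blast
      ultimately show ?thesis unfolding mem by (rule bexI[rotated])
    next
      case False
      with exchange[OF W(1)] obtain u where u: "u \<in> W" "insert x (W - {u}) \<in> \<W>" by blast
      with False have "W - {u} \<in> ?J" by auto
      moreover have "F \<subseteq> X - {x} - (W - {u})" using W by blast
      ultimately show ?thesis unfolding mem by (rule bexI[rotated])
    qed
  next
    fix F assume "F \<in> cofacet_complex (X - {x}) ?J"
    then obtain U where "x \<notin> U" "insert x U \<in> \<W>" "F \<subseteq> X - {x} - U"
      unfolding mem by blast
    moreover from this have "F \<in> ?D" unfolding mem by (intro bexI[of _ "insert x U"]) auto
    ultimately show "F \<in> complex_del ?D x" by (auto simp: complex_del_def)
  qed
  show ?thesis
  \<comment> \<open>Shedding requires \<open>x\<close> to be a vertex of the complex. If it lies in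
    no face, the complex equals its deletion.\<close>
  proof (cases "x \<in> \<Union>?D")
    case False
    then have "?D = complex_del ?D x" by (auto simp: complex_del_def)
    then show ?thesis using del del_eq by simp
  next
    case True
    have "simplicial_complex ?D"
      unfolding simplicial_complex_def mem
    proof (intro conjI ballI allI impI)
      show "finite (\<Union>?D)"
        by (rule finite_subset[OF _ X(1)]) (auto simp: generated_complex_def)
      show "\<exists>W\<in>\<W>. F' \<subseteq> X - W" if "F \<in> ?D" "F' \<subseteq> F" for F F'
        using that unfolding mem by blast
    qed
    moreover have "complex_link ?D x = cofacet_complex (X - {x}) {W \<in> \<W>. x \<notin> W}"
    proof (intro set_eqI iffI)
      fix F assume "F \<in> complex_link ?D x"
      then obtain W where W: "x \<notin> F" "W \<in> \<W>" "insert x F \<subseteq> X - W"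
        unfolding complex_link_def mem by blast
      then have "W \<in> {W \<in> \<W>. x \<notin> W}" "F \<subseteq> X - {x} - W" by blast+
      then show "F \<in> cofacet_complex (X - {x}) {W \<in> \<W>. x \<notin> W}"
        unfolding mem by (rule bexI[rotated])
    next
      fix F assume "F \<in> cofacet_complex (X - {x}) {W \<in> \<W>. x \<notin> W}"
      then obtain W where W: "W \<in> \<W>" "x \<notin> W" "F \<subseteq> X - {x} - W"
        unfolding mem by blast
      then have "insert x F \<subseteq> X - W" "x \<notin> F" using X(2) by blast+
      moreover from this(1) W(1) have "insert x F \<in> ?D" unfolding mem by (rule bexI)
      ultimately show "F \<in> complex_link ?D x" by (simp add: complex_link_def)
    qed
    moreover have "facets (complex_del ?D x) \<subseteq> facets ?D"
    proof
      fix F assume F: "F \<in> facets (complex_del ?D x)"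
      then have "F \<in> cofacet_complex (X - {x}) ?J" by (simp add: facets_def del_eq)
      then obtain U where U: "x \<notin> U" "insert x U \<in> \<W>" "F \<subseteq> X - {x} - U"
        unfolding mem by blast
      have "X - {x} - U \<in> complex_del ?D x"
        unfolding del_eq mem by (rule bexI[of _ U]) (use U in auto)
      with F U(3) have "X - {x} - U = F" by (simp add: facets_def)
      then have "F = X - insert x U" by blast
      moreover have "F' = X - insert x U" if "F' \<in> ?D" "X - insert x U \<subseteq> F'" for F'
      proof -
        \<comment> \<open>All members have size \<open>r\<close>, so an inclusion between two of
          them is an equality; hence no face properly contains the complement of a member.\<close>
        from that(1) obtain W where W: "W \<in> \<W>" "F' \<subseteq> X - W" unfolding mem by blast
        with that(2) have "W \<subseteq> insert x U" using \<W>[OF W(1)] by blast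
        moreover have "finite (insert x U)" using \<W>[OF U(2)] finite_subset[OF _ X(1)] by blast
        ultimately have "W = insert x U"
          using \<W>[OF W(1)] \<W>[OF U(2)] by (metis card_subset_eq)
        then show ?thesis using W(2) that(2) by blast
      qed
      moreover have "X - insert x U \<in> ?D" unfolding mem using U(2) by blast
      ultimately show "F \<in> facets ?D" by (simp add: facets_def)
    qed
    ultimately show ?thesis
      using vertex_decomposable.shed[OF _ True] link del del_eq by simp
  qed
qed

text \<open>No chordality is needed once a connected set \<open>S\<close> is prescribed: every neighbour of \<open>S\<close>
  is a shedding vertex, and its deletion amounts to adding it to \<open>S\<close>.\<close>

lemma vertex_decomposable_rooted:
  assumes "sym E" "finite X" "finite S" "linked E S" "S \<inter> X = {}"
  shows "vertex_decomposable (cofacet_complex X {U. U \<subseteq> X \<and> card U = k \<and> linked E (S \<union> U)})"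
  using assms(2-)
proof (induction "card X" arbitrary: X S k rule: less_induct)
  case less
  let ?F = "\<lambda>X S k. {U. U \<subseteq> X \<and> card U = k \<and> linked E (S \<union> U)}"
  show ?case
  proof (cases k)
    case 0
    have "U = {}" if "U \<subseteq> X" "card U = 0" for U
      using that less.prems(1) finite_subset by fastforce
    then have "?F X S k = {{}}" using 0 less.prems(3) by auto
    then show ?thesis
      using vertex_decomposable.simplex[OF less.prems(1)] by (simp add: generated_complex_singleton)
  next
    case (Suc k')
    show ?thesis
    proof (cases "\<exists>s\<in>S. \<exists>y\<in>X. (s, y) \<in> E")
      case False
      \<comment> \<open>With no edge from \<open>S\<close> into \<open>X\<close>, the cut
        \<open>S\<close> separates it from any nonempty \<open>U\<close>, and the complex is
        void.\<close>
      have "\<not> linked E (S \<union> U)" if U: "U \<subseteq> X" "card U = k" for U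
      proof
        assume l: "linked E (S \<union> U)"
        have "U \<noteq> {}" using U(2) Suc by auto
        then have "S \<subset> S \<union> U" using U(1) less.prems(4) by blast
        from linked_cutE[OF l linked_nonempty[OF less.prems(3)] this] False U(1)
        show False by blast
      qed
      then have "?F X S k = {}" by blast
      then show ?thesis
        using vertex_decomposable.void by (simp only: image_empty generated_complex_empty)
    next
      case True
      then obtain s y where y: "s \<in> S" "y \<in> X" "(s, y) \<in> E" by blast
      have link: "{U \<in> ?F X S k. y \<notin> U} = ?F (X - {y}) S k" by auto
      have card: "card (X - {y}) < card X" using less.prems(1) y(2) by (rule card_Diff1_less)
      have S': "linked E (insert y S)" using linked_insert[OF assms(1) less.prems(3) y(1,3)] .
      \<comment> \<open>Deletion moves \<open>y\<close> from \<open>X\<close> into the root set and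
        lowers the number of vertices still to be chosen by one.\<close>
      have del: "{U. y \<notin> U \<and> insert y U \<in> ?F X S k} = ?F (X - {y}) (insert y S) k'"
      proof (intro set_eqI iffI)
        fix U assume U: "U \<in> {U. y \<notin> U \<and> insert y U \<in> ?F X S k}"
        then have "finite U" using less.prems(1) by (auto intro: finite_subset)
        moreover have "S \<union> insert y U = insert y S \<union> U" by blast
        ultimately show "U \<in> ?F (X - {y}) (insert y S) k'"
          using U Suc by (clarsimp simp: subset_Diff_insert)
      next
        fix U assume U: "U \<in> ?F (X - {y}) (insert y S) k'"
        then have "finite U" using finite_subset[OF _ less.prems(1)] by blast
        moreover have "S \<union> insert y U = insert y S \<union> U" by blast
        ultimately show "U \<in> {U. y \<notin> U \<and> insert y U \<in> ?F X S k}"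
          using U Suc y(2) by (clarsimp simp: subset_Diff_insert)
      qed
      show ?thesis
      proof (rule vertex_decomposable_cofacet_complex[of X y _ k])
        show "\<exists>u\<in>U. insert y (U - {u}) \<in> ?F X S k" if U: "U \<in> ?F X S k" "y \<notin> U" for U
        proof -
          let ?T = "insert y (S \<union> U)"
          have "finite U" using U(1) finite_subset[OF _ less.prems(1)] by blast
          have "U \<noteq> {}" using U(1) Suc by auto
          then obtain w where "w \<in> U" by blast
          then have "w \<in> ?T - insert y S" using U less.prems(4) by blast
          then have "insert y S \<subset> ?T" by blast
          moreover have "linked E ?T"
            using linked_insert[OF assms(1), of "S \<union> U"] U(1) y by blast
          moreover have "finite ?T" using \<open>finite U\<close> less.prems(2) by simp
          \<comment> \<open>A non-cut vertex outside \<open>insert y S\<close> lies in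
            \<open>U\<close>, so it can be traded for \<open>y\<close> with the root set
            kept.\<close>
          ultimately obtain u where u: "u \<in> ?T - insert y S" "linked E (?T - {u})"
            using linked_noncut_vertex[OF assms(1)] S' by metis
          have "?T - {u} = S \<union> insert y (U - {u})" using u(1) by blast
          moreover have "card (insert y (U - {u})) = k"
            using u(1) U \<open>finite U\<close> Suc by auto
          moreover have "insert y (U - {u}) \<subseteq> X" using U(1) y(2) by blast
          ultimately show ?thesis using u by auto
        qed
        show "vertex_decomposable (cofacet_complex (X - {y}) {U \<in> ?F X S k. y \<notin> U})"
          unfolding link by (rule less.hyps[OF card]) (use less.prems in auto)
        show "vertex_decomposable
            (cofacet_complex (X - {y}) {U. y \<notin> U \<and> insert y U \<in> ?F X S k})"
          unfolding del by (rule less.hyps[OF card]) (use less.prems S' in auto)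
      qed (use less.prems y in auto)
    qed
  qed
qed

text \<open>A vertex \<open>x\<close> that is simplicial in the complement meets every edge of \<open>G\<close> in its closed
  neighbourhood, so it is adjacent to every connected set with at least two vertices.\<close>

lemma vertex_decomposable_linked_sets:
  assumes G: "pair_graph G" and "r \<ge> 2" and "co_chordal G" and "X \<subseteq> pverts G"
  shows "vertex_decomposable
    (cofacet_complex X {W. W \<subseteq> X \<and> card W = r \<and> linked (parcs G) W})"
  using assms(4)
proof (induction "card X" arbitrary: X rule: less_induct)
  case less
  interpret pair_graph G by (fact G)
  let ?E = "parcs G"
  have sym: "sym ?E"
    using pair_sym_arcs by (simp add: symmetric_def)
  have finX: "finite X" using less.prems pair_finite_verts by (rule finite_subset)
  let ?F = "\<lambda>X. {W. W \<subseteq> X \<and> card W = r \<and> linked ?E W}"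
  show ?case
  proof (cases "X = {}")
    case True
    then have "?F X = {}" using assms(2) by auto
    then show ?thesis
      using vertex_decomposable.void by (simp only: image_empty generated_complex_empty)
  next
    case False
    have "X \<subseteq> pverts (graph_complement G)"
      using less.prems by (simp add: graph_complement_def)
    with False obtain x where x: "x \<in> X"
      and simplicial: "\<And>a b. a \<in> X \<Longrightarrow> b \<in> X \<Longrightarrow> (x, a) \<in> parcs (graph_complement G) \<Longrightarrow>
        (x, b) \<in> parcs (graph_complement G) \<Longrightarrow> a \<noteq> b \<Longrightarrow> (a, b) \<in> parcs (graph_complement G)"
      using chordal_simplicial_vertex[OF pair_graph_graph_complement[OF G]] assms(3)
      unfolding co_chordal_def by metis
    \<comment> \<open>Two distinct vertices of \<open>X - {x}\<close> that \<open>x\<close> misses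
      in \<open>G\<close> are its neighbours in the complement, hence adjacent there and not in
      \<open>G\<close>.\<close>
    have adj: "(x, a) \<in> ?E \<or> (x, b) \<in> ?E"
      if "(a, b) \<in> ?E" "a \<in> X - {x}" "b \<in> X - {x}" for a b
      using that simplicial[of a b] less.prems x pair_no_loops[OF that(1)]
      by (auto simp: graph_complement_def)
    have link: "{W \<in> ?F X. x \<notin> W} = ?F (X - {x})" by auto
    \<comment> \<open>The deletion is the rooted family with root set \<open>{x}\<close> and
      \<open>r - 1\<close> vertices to choose.\<close>
    have del: "{U. x \<notin> U \<and> insert x U \<in> ?F X} =
      {U. U \<subseteq> X - {x} \<and> card U = r - 1 \<and> linked ?E ({x} \<union> U)}"
    proof (intro set_eqI iffI)
      fix U assume U: "U \<in> {U. x \<notin> U \<and> insert x U \<in> ?F X}"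
      then have "finite U" using finite_subset[OF _ finX] by blast
      then show "U \<in> {U. U \<subseteq> X - {x} \<and> card U = r - 1 \<and> linked ?E ({x} \<union> U)}"
        using U by auto
    next
      fix U assume U: "U \<in> {U. U \<subseteq> X - {x} \<and> card U = r - 1 \<and> linked ?E ({x} \<union> U)}"
      then have "finite U" using finite_subset[OF _ finX] by blast
      moreover have "x \<notin> U" using U by blast
      ultimately show "U \<in> {U. x \<notin> U \<and> insert x U \<in> ?F X}" using U x assms(2) by auto
    qed
    show ?thesis
    proof (rule vertex_decomposable_cofacet_complex[of X x _ r])
      show "\<exists>u\<in>W. insert x (W - {u}) \<in> ?F X" if W: "W \<in> ?F X" "x \<notin> W" for W
      proof -
        have finW: "finite W" using W(1) finite_subset[OF _ finX] by blast
        have "W \<noteq> {}" using W(1) linked_nonempty by blast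
        then obtain w where w: "w \<in> W" by blast
        have "{w} \<noteq> W" using W(1) assms(2) by auto
        with w have "{w} \<subset> W" by blast
        \<comment> \<open>As \<open>r \<ge> 2\<close>, cutting off the single vertex
          \<open>w\<close> yields an edge inside \<open>W\<close>, one end of which is adjacent to
          \<open>x\<close>.\<close>
        with W(1) obtain a b where ab: "a \<in> {w}" "b \<in> W - {w}" "(a, b) \<in> ?E"
          by (metis (no_types, lifting) insert_not_empty linked_cutE mem_Collect_eq)
        then have "(x, a) \<in> ?E \<or> (x, b) \<in> ?E" using adj W w by blast
        then obtain c where c: "c \<in> W" "(c, x) \<in> ?E" using ab w sym by (auto dest: symD)
        have "linked ?E (insert x W)" using linked_insert[OF sym _ c] W(1) by blast
        moreover have "{x} \<subset> insert x W" using w W(2) by blast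
        ultimately obtain u where u: "u \<in> insert x W - {x}" "linked ?E (insert x W - {u})"
          using linked_noncut_vertex[OF sym _ _ linked_singleton] finW by (metis finite_insert)
        have "insert x W - {u} = insert x (W - {u})" using u(1) by blast
        moreover have "card (insert x (W - {u})) = r"
          using u(1) W finW assms(2) by simp
        ultimately show ?thesis using u W(1) x by auto
      qed
      show "vertex_decomposable (cofacet_complex (X - {x}) {W \<in> ?F X. x \<notin> W})"
        unfolding link
        by (rule less.hyps[OF card_Diff1_less[OF finX x]]) (use less.prems in auto)
      show "vertex_decomposable
          (cofacet_complex (X - {x}) {U. x \<notin> U \<and> insert x U \<in> ?F X})"
        unfolding del
        by (rule vertex_decomposable_rooted[OF sym]) (use finX linked_singleton in auto)
    qed (use finX x in auto)
  qed
qed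

theorem theorem4p3:
  fixes G :: "'a pair_pre_digraph" and r :: nat
  assumes "pair_graph G"
    and "r \<ge> 2"
    and "co_chordal G"
  shows "vertex_decomposable (sigma_complex r G)"
proof -
  have "sigma_complex r G =
    cofacet_complex (pverts G) {W. W \<subseteq> pverts G \<and> card W = r \<and> linked (parcs G) W}"
    unfolding sigma_complex_def using connected_induce_iff_linked[OF assms(1)]
    by (intro arg_cong[of _ _ generated_complex]) blast
  then show ?thesis using vertex_decomposable_linked_sets[OF assms order_refl] by simp
qed

end
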